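(* Let $M$ be a connected $2$-polymatroid and let $N$ be a connected minor of $M$. If $N \neq M$, then there is an element $e$ of $E(M) - E(N)$ such that at least one of $M \backslash e$ and $M / e$ is connected and has $N$ as a minor.
   Context: For a positive integer $k$, a $k$-polymatroid $M$ is a pair $(E,r)$ consisting of a finite set $E=E(M)$ (the ground set) and a function $r=r_M$ (the rank function) from the power set of $E$ into the integers such that: (i) $r(\emptyset)=0$; (ii) $r(X)\le r(Y)$ whenever $X\subseteq Y\subseteq E$; (iii) $r(X)+r(Y)\ge r(X\cup Y)+r(X\cap Y)$ for all $X,Y\subseteq E$; (iv) $r(\{e\})\le k$ for all $e\in E$. A $2$-polymatroid is the case $k=2$. For $T\subseteq E$, the deletion $M\backslash T$ and the contraction $M/T$ are the polymatroids on ground set $E-T$ with rank functions $r_{M\backslash T}(X)=r(X)$ and $r_{M/T}(X)=r(X\cup T)-r(T)$ for all $X\subseteq E-T$. Write $M\backslash e$ and $M/e$ for $M\backslash\{e\}$ and $M/\{e\}$. A minor of $M$ is any polymatroid obtained from $M$ by a (possibly empty) sequence of deletions and contractions; thus the ground set of a minor is a subset of $E(M)$, and "having $N$ as a minor" means equality with such a polymatroid (not merely isomorphism). A polymatroid $(E,r)$ is connected if there is no non-empty proper subset $X$ of $E$ such that $r(X)+r(E-X)=r(E)$. *)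

theory Defs
  imports Main "HOL-Library.FuncSet"
begin

text \<open>
  The rank function of a polymatroid with ground set E is a function on the power set of E.
  As HOL functions are total, it is required to be extensional on \<open>Pow E\<close>, and deletion and
  contraction restrict their rank functions accordingly. Hence two polymatroids are equal as
  HOL values iff they have the same ground set and the same rank function on its power set.
\<close>

record 'a polymatroid =
  ground :: "'a set"
  rk :: "'a set \<Rightarrow> int"

definition k_polymatroid :: "nat \<Rightarrow> 'a polymatroid \<Rightarrow> bool" where
  "k_polymatroid k M \<longleftrightarrow>
     finite (ground M) \<and>
     rk M \<in> extensional (Pow (ground M)) \<and>
     rk M {} = 0 \<and>
     (\<forall>X Y. X \<subseteq> Y \<and> Y \<subseteq> ground M \<longrightarrow> rk M X \<le> rk M Y) \<and>
     (\<forall>X Y. X \<subseteq> ground M \<and> Y \<subseteq> ground M \<longrightarrow>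
        rk M X + rk M Y \<ge> rk M (X \<union> Y) + rk M (X \<inter> Y)) \<and>
     (\<forall>e\<in>ground M. rk M {e} \<le> int k)"

definition pm_delete :: "'a polymatroid \<Rightarrow> 'a set \<Rightarrow> 'a polymatroid" where
  "pm_delete M T =
     \<lparr> ground = ground M - T,
       rk = (\<lambda>X\<in>Pow (ground M - T). rk M X) \<rparr>"

definition pm_contract :: "'a polymatroid \<Rightarrow> 'a set \<Rightarrow> 'a polymatroid" where
  "pm_contract M T =
     \<lparr> ground = ground M - T,
       rk = (\<lambda>X\<in>Pow (ground M - T). rk M (X \<union> T) - rk M T) \<rparr>"

inductive pm_minor :: "'a polymatroid \<Rightarrow> 'a polymatroid \<Rightarrow> bool" where
  refl: "pm_minor M M"
| delete: "pm_minor N M \<Longrightarrow> T \<subseteq> ground N \<Longrightarrow> pm_minor (pm_delete N T) M"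
| contract: "pm_minor N M \<Longrightarrow> T \<subseteq> ground N \<Longrightarrow> pm_minor (pm_contract N T) M"

text \<open>The polymatroid with empty ground set is connected.\<close>

definition pm_connected :: "'a polymatroid \<Rightarrow> bool" where
  "pm_connected M \<longleftrightarrow>
     \<not> (\<exists>X. X \<noteq> {} \<and> X \<subset> ground M \<and> rk M X + rk M (ground M - X) = rk M (ground M))"

end

theory Submission
  imports Defs
begin

text \<open>
  Suppose that \<open>N\<close> is a minor of \<open>M \ e\<close> and that \<open>(A, B)\<close> is a separation of \<open>M \ e\<close>. Since \<open>N\<close> is
  connected, it lives on one side, say \<open>A\<close>, and then it is a minor of both \<open>M \ b\<close> and \<open>M / b\<close> for
  every \<open>b \<in> B\<close>. Uncrossing \<open>(A, B)\<close> with a separation of \<open>M / b\<close> shows that the side of the latter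
  avoiding \<open>e\<close> is contained in \<open>B - {b}\<close>; its complement contains \<open>A\<close>, hence \<open>N\<close>. The dual holds for
  \<open>M / e\<close> and \<open>M \ b\<close>. So each failure yields a separation with a strictly smaller side
  avoiding \<open>N\<close>, and the descent ends with a connected deletion or contraction.
\<close>

section \<open>Normalised submodular set functions and their separations\<close>

definition submodular_on :: "'a set \<Rightarrow> ('a set \<Rightarrow> int) \<Rightarrow> bool" where
  "submodular_on E f \<longleftrightarrow> f {} = 0 \<and>
     (\<forall>X Y. X \<subseteq> E \<and> Y \<subseteq> E \<longrightarrow> f (X \<union> Y) + f (X \<inter> Y) \<le> f X + f Y)"

text \<open>Both sides are arguments because the proof has to track which of them contains
  \<open>e\<close> and which contains \<open>ground N\<close>.\<close>

definition separation :: "'a set \<Rightarrow> ('a set \<Rightarrow> int) \<Rightarrow> 'a set \<Rightarrow> 'a set \<Rightarrow> bool" where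
  "separation E f A B \<longleftrightarrow>
     A \<noteq> {} \<and> B \<noteq> {} \<and> A \<inter> B = {} \<and> A \<union> B = E \<and> f A + f B = f E"

lemma separation_commute: "separation E f A B \<longleftrightarrow> separation E f B A"
  unfolding separation_def by (auto simp: Int_commute Un_commute add.commute)

lemma separation_cong:
  assumes "\<And>X. X \<subseteq> E \<Longrightarrow> f X = g X"
  shows "separation E f A B \<longleftrightarrow> separation E g A B"
  using assms[of A] assms[of B] assms[of E] unfolding separation_def by auto

lemma submodular_onD:
  assumes "submodular_on E f" "X \<subseteq> E" "Y \<subseteq> E"
  shows "f (X \<union> Y) + f (X \<inter> Y) \<le> f X + f Y"
  using assms unfolding submodular_on_def by blast

lemma submodular_on_subset: "submodular_on E f \<Longrightarrow> F \<subseteq> E \<Longrightarrow> submodular_on F f"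
  unfolding submodular_on_def by (meson order_trans)

lemma submodular_on_contract:
  assumes "submodular_on E f" "T \<subseteq> E"
  shows "submodular_on (E - T) (\<lambda>X. f (X \<union> T) - f T)"
  unfolding submodular_on_def
proof (intro conjI allI impI)
  fix X Y assume "X \<subseteq> E - T \<and> Y \<subseteq> E - T"
  hence "X \<subseteq> E" "Y \<subseteq> E" by auto
  moreover have "(X \<union> T) \<union> (Y \<union> T) = (X \<union> Y) \<union> T" "(X \<union> T) \<inter> (Y \<union> T) = (X \<inter> Y) \<union> T" by auto
  ultimately show "f (X \<union> Y \<union> T) - f T + (f (X \<inter> Y \<union> T) - f T) \<le> f (X \<union> T) - f T + (f (Y \<union> T) - f T)"
    using submodular_onD[OF assms(1), of "X \<union> T" "Y \<union> T"] assms(2) by auto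
qed simp

text \<open>The dual rank function without its modular term, which affects neither submodularity nor
  separations but would only restore monotonicity.\<close>

lemma submodular_on_dual:
  assumes "submodular_on E f"
  shows "submodular_on E (\<lambda>X. f (E - X) - f E)"
  unfolding submodular_on_def
proof (intro conjI allI impI)
  fix X Y assume "X \<subseteq> E \<and> Y \<subseteq> E"
  show "f (E - (X \<union> Y)) - f E + (f (E - (X \<inter> Y)) - f E) \<le> f (E - X) - f E + (f (E - Y) - f E)"
    using submodular_onD[OF assms, of "E - X" "E - Y"]
    by (simp add: Diff_Int Diff_Un)
qed simp

text \<open>Subadditivity gives \<open>\<le>\<close>. For the converse, add submodularity for
  \<open>Z\<close>, \<open>A\<close> to that for \<open>Z \<union> A\<close>, \<open>B\<close>; then
  \<open>f (Z \<union> A)\<close> cancels, and so does \<open>f A + f B\<close> against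
  \<open>f E\<close>.\<close>

lemma separation_split:
  assumes sub: "submodular_on E f" and sep: "separation E f A B" and Z: "Z \<subseteq> E"
  shows "f Z = f (Z \<inter> A) + f (Z \<inter> B)"
proof -
  have AB: "A \<inter> B = {}" "A \<union> B = E" "f A + f B = f E" and f0: "f {} = 0"
    using sep sub unfolding separation_def submodular_on_def by auto
  have "(Z \<inter> A) \<union> (Z \<inter> B) = Z" "(Z \<inter> A) \<inter> (Z \<inter> B) = {}" using AB Z by auto
  hence 1: "f Z \<le> f (Z \<inter> A) + f (Z \<inter> B)"
    using submodular_onD[OF sub, of "Z \<inter> A" "Z \<inter> B"] AB Z f0 by auto
  have 2: "f (Z \<union> A) + f (Z \<inter> A) \<le> f Z + f A"
    using submodular_onD[OF sub] AB Z by auto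
  have "(Z \<union> A) \<union> B = E" "(Z \<union> A) \<inter> B = Z \<inter> B" using AB Z by auto
  hence 3: "f E + f (Z \<inter> B) \<le> f (Z \<union> A) + f B"
    using submodular_onD[OF sub, of "Z \<union> A" B] AB Z by auto
  from 1 2 3 AB show ?thesis by linarith
qed

section \<open>Uncrossing separations\<close>

text \<open>Splitting one set along \<open>A\<close>, \<open>B\<close> and another along
  \<open>X\<close>, \<open>Y\<close> shows that the ranks of \<open>A \<inter> Y\<close> and of its
  complement in \<open>E\<close> add up to \<open>f E\<close>. As \<open>f\<close> has no separation
  on \<open>E\<close>, the set \<open>A \<inter> Y\<close> is empty.\<close>

lemma uncross_deletion_contraction:
  assumes sub: "submodular_on E f" and conn: "\<And>A B. \<not> separation E f A B"
    and e: "e \<in> E" and AB: "separation (E - {e}) f A B" and b: "b \<in> B"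
    and XY: "separation (E - {b}) (\<lambda>X. f (insert b X) - f {b}) X Y" and eX: "e \<in> X"
  shows "Y \<subseteq> B - {b}"
proof -
  let ?g = "\<lambda>X. f (insert b X) - f {b}"
  have A: "A \<inter> B = {}" "A \<union> B = E - {e}" using AB unfolding separation_def by auto
  have X: "X \<inter> Y = {}" "X \<union> Y = E - {b}" using XY unfolding separation_def by auto
  have bE: "b \<in> E" using A b by auto
  have subg: "submodular_on (E - {b}) ?g"
    using submodular_on_contract[OF sub, of "{b}"] bE by simp
  note splitf = separation_split[OF submodular_on_subset[OF sub Diff_subset] AB]
  note splitg = separation_split[OF subg XY]
  have bY: "insert b Y \<subseteq> E - {e}" using X A b eX by blast
  have "insert b Y \<inter> A = A \<inter> Y" "insert b Y \<inter> B = insert b (Y \<inter> B)" using A b by auto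
  hence 1: "f (insert b Y) = f (A \<inter> Y) + f (insert b (Y \<inter> B))"
    using splitf[of "insert b Y"] bY by simp
  \<comment> \<open>This set is chosen because adding \<open>b\<close> turns it into the complement
    of \<open>A \<inter> Y\<close>: an element of \<open>Y\<close> outside \<open>A\<close> differs
    from \<open>e\<close>, hence lies in \<open>B\<close>.\<close>
  have "(X \<union> (Y \<inter> B)) \<inter> X = X" "(X \<union> (Y \<inter> B)) \<inter> Y = Y \<inter> B" using X by auto
  hence 2: "?g (X \<union> (Y \<inter> B)) = ?g X + ?g (Y \<inter> B)"
    using splitg[of "X \<union> (Y \<inter> B)"] X by auto
  have "insert b (X \<union> (Y \<inter> B)) = E - (A \<inter> Y)" using X A b bE eX by blast
  with 2 have 3: "f (E - (A \<inter> Y)) - f {b} = ?g X + ?g (Y \<inter> B)" by simp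
  have "insert b (E - {b}) = E" using bE by auto
  hence 4: "?g X + ?g Y = f E - f {b}" using XY unfolding separation_def by auto
  from 1 3 4 have 5: "f (A \<inter> Y) + f (E - (A \<inter> Y)) = f E" by simp
  \<comment> \<open>The complement contains \<open>e\<close>, so only \<open>A \<inter> Y\<close>
    can be the empty side.\<close>
  have "E - (A \<inter> Y) \<noteq> {}" "A \<inter> Y \<subseteq> E" using e A by auto
  hence "A \<inter> Y = {}"
    using 5 conn[of "A \<inter> Y" "E - (A \<inter> Y)"] unfolding separation_def by auto
  thus ?thesis using X A eX by auto
qed

text \<open>Duality: passing to \<open>?h\<close> keeps the separations of \<open>E\<close> and
  exchanges deletion with contraction, which reduces the claim to the previous lemma.\<close>

lemma uncross_contraction_deletion:
  assumes sub: "submodular_on E f" and conn: "\<And>A B. \<not> separation E f A B"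
    and e: "e \<in> E" and AB: "separation (E - {e}) (\<lambda>X. f (insert e X) - f {e}) A B" and b: "b \<in> B"
    and XY: "separation (E - {b}) f X Y" and eX: "e \<in> X"
  shows "Y \<subseteq> B - {b}"
proof -
  let ?h = "\<lambda>X. f (E - X) - f E"
  have f0: "f {} = 0" using sub unfolding submodular_on_def by auto
  have A: "A \<inter> B = {}" "A \<union> B = E - {e}" "A \<noteq> {}" "B \<noteq> {}"
    and Ar: "f (insert e A) - f {e} + (f (insert e B) - f {e}) = f (insert e (E - {e})) - f {e}"
    using AB unfolding separation_def by auto
  have X: "X \<inter> Y = {}" "X \<union> Y = E - {b}" "X \<noteq> {}" "Y \<noteq> {}" "f X + f Y = f (E - {b})"
    using XY unfolding separation_def by auto
  have bE: "b \<in> E" using A b by auto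
  have "\<not> separation E ?h P Q" for P Q
  proof
    assume s: "separation E ?h P Q"
    hence "E - P = Q" "E - Q = P" unfolding separation_def by auto
    with s f0 have "separation E f P Q" unfolding separation_def by auto
    thus False using conn by blast
  qed
  moreover have "separation (E - {e}) ?h A B"
  proof -
    have "E - A = insert e B" "E - B = insert e A" "E - (E - {e}) = {e}" "insert e (E - {e}) = E"
      using A e by auto
    thus ?thesis using A Ar unfolding separation_def by auto
  qed
  moreover have "separation (E - {b}) (\<lambda>X. ?h (insert b X) - ?h {b}) X Y"
  proof -
    \<comment> \<open>Contracting \<open>b\<close> under \<open>?h\<close> gives \<open>X\<close>
      the value \<open>f Y - f (E - {b})\<close>, so the separation equation is that of
      \<open>f\<close> with the sides swapped.\<close>
    have "E - insert b X = Y" "E - insert b Y = X" "insert b (E - {b}) = E" using X bE by auto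
    thus ?thesis using X f0 unfolding separation_def by auto
  qed
  ultimately show ?thesis
    using uncross_deletion_contraction[OF submodular_on_dual[OF sub] _ e _ b _ eX] by blast
qed

section \<open>Transfer to polymatroids, their deletions and contractions\<close>

lemma pm_connected_iff: "pm_connected M \<longleftrightarrow> (\<forall>A B. \<not> separation (ground M) (rk M) A B)"
proof
  assume c: "pm_connected M"
  show "\<forall>A B. \<not> separation (ground M) (rk M) A B"
  proof (intro allI notI)
    fix A B assume s: "separation (ground M) (rk M) A B"
    hence "ground M - A = B" "A \<subset> ground M" "A \<noteq> {}" unfolding separation_def by auto
    with s c show False unfolding separation_def pm_connected_def by auto
  qed
next
  assume s: "\<forall>A B. \<not> separation (ground M) (rk M) A B"
  show "pm_connected M" unfolding pm_connected_def
  proof (intro notI, elim exE conjE)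
    fix X assume "X \<noteq> {}" "X \<subset> ground M" "rk M X + rk M (ground M - X) = rk M (ground M)"
    hence "separation (ground M) (rk M) X (ground M - X)" unfolding separation_def by auto
    thus False using s by blast
  qed
qed

lemma ground_pm_delete [simp]: "ground (pm_delete M T) = ground M - T"
  and ground_pm_contract [simp]: "ground (pm_contract M T) = ground M - T"
  by (simp_all add: pm_delete_def pm_contract_def)

lemma rk_pm_delete: "X \<subseteq> ground M - T \<Longrightarrow> rk (pm_delete M T) X = rk M X"
  and rk_pm_contract: "X \<subseteq> ground M - T \<Longrightarrow> rk (pm_contract M T) X = rk M (X \<union> T) - rk M T"
  by (simp_all add: pm_delete_def pm_contract_def)

lemma separation_pm_delete:
  "separation (ground M - T) (rk (pm_delete M T)) A B \<longleftrightarrow> separation (ground M - T) (rk M) A B"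
  by (rule separation_cong) (simp add: rk_pm_delete)

lemma separation_pm_contract:
  "separation (ground M - {e}) (rk (pm_contract M {e})) A B \<longleftrightarrow>
   separation (ground M - {e}) (\<lambda>X. rk M (insert e X) - rk M {e}) A B"
  by (rule separation_cong) (simp add: rk_pm_contract)

abbreviation submodular_pm :: "'a polymatroid \<Rightarrow> bool" where
  "submodular_pm M \<equiv> submodular_on (ground M) (rk M)"

lemma submodular_on_cong:
  assumes "\<And>X. X \<subseteq> E \<Longrightarrow> f X = g X"
  shows "submodular_on E f \<longleftrightarrow> submodular_on E g"
  unfolding submodular_on_def using assms
  by (smt (verit) Un_least empty_subsetI inf.coboundedI1)

lemma submodular_pm_delete:
  assumes "submodular_pm M"
  shows "submodular_pm (pm_delete M T)"
proof -
  have "submodular_on (ground M - T) (rk (pm_delete M T)) \<longleftrightarrow> submodular_on (ground M - T) (rk M)"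
    by (rule submodular_on_cong) (simp add: rk_pm_delete)
  thus ?thesis using submodular_on_subset[OF assms Diff_subset] by simp
qed

lemma submodular_pm_contract:
  assumes "submodular_pm M" "T \<subseteq> ground M"
  shows "submodular_pm (pm_contract M T)"
proof -
  have "submodular_on (ground M - T) (rk (pm_contract M T)) \<longleftrightarrow>
    submodular_on (ground M - T) (\<lambda>X. rk M (X \<union> T) - rk M T)"
    by (rule submodular_on_cong) (simp add: rk_pm_contract)
  thus ?thesis using submodular_on_contract[OF assms] by simp
qed

section \<open>Normal form of minors\<close>

lemma pm_minor_trans:
  assumes "pm_minor N K" "pm_minor K M"
  shows "pm_minor N M"
  using assms by (induction rule: pm_minor.induct) (auto intro: pm_minor.intros)

text \<open>One set \<open>C\<close> records the whole sequence of operations: a deletion leaves it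
  alone and a contraction adds \<open>T\<close> to it, the terms \<open>rk M C\<close> cancelling.
  Extensionality of \<open>rk M\<close> settles the empty sequence.\<close>

lemma pm_minorE:
  assumes "pm_minor N M" "rk M \<in> extensional (Pow (ground M))" "rk M {} = 0"
  obtains C where "ground N \<subseteq> ground M" "C \<subseteq> ground M - ground N"
    "rk N = (\<lambda>X\<in>Pow (ground N). rk M (X \<union> C) - rk M C)"
proof -
  from assms have "\<exists>C. ground N \<subseteq> ground M \<and> C \<subseteq> ground M - ground N \<and>
    rk N = (\<lambda>X\<in>Pow (ground N). rk M (X \<union> C) - rk M C)"
  proof (induction rule: pm_minor.induct)
    case (refl M)
    thus ?case by (intro exI[of _ "{}"]) (auto simp: extensional_restrict)
  next
    case (delete N M T)
    then obtain C where "ground N \<subseteq> ground M" "C \<subseteq> ground M - ground N"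
      "rk N = (\<lambda>X\<in>Pow (ground N). rk M (X \<union> C) - rk M C)" by blast
    thus ?case by (intro exI[of _ C]) (auto simp: pm_delete_def fun_eq_iff)
  next
    case (contract N M T)
    then obtain C where "ground N \<subseteq> ground M" "C \<subseteq> ground M - ground N"
      "rk N = (\<lambda>X\<in>Pow (ground N). rk M (X \<union> C) - rk M C)" by blast
    with contract.hyps show ?case
      by (intro exI[of _ "C \<union> T"]) (auto simp: pm_contract_def fun_eq_iff Un_ac)
  qed
  thus thesis using that by blast
qed

text \<open>Contract \<open>C\<close> first, then delete whatever is left outside
  \<open>ground N\<close>.\<close>

lemma pm_minorI:
  assumes "ground N \<subseteq> ground M" "C \<subseteq> ground M - ground N"
    "rk N = (\<lambda>X\<in>Pow (ground N). rk M (X \<union> C) - rk M C)"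
  shows "pm_minor N M"
proof -
  let ?K = "pm_contract M C"
  have g: "ground ?K - (ground ?K - ground N) = ground N" using assms by auto
  have "N = pm_delete ?K (ground ?K - ground N)"
    unfolding pm_delete_def g using assms(1,2)
    by (intro polymatroid.equality) (auto simp: assms(3) fun_eq_iff intro!: rk_pm_contract[symmetric])
  moreover have "pm_minor ?K M" using assms by (intro pm_minor.intros) auto
  ultimately show ?thesis by (metis pm_minor.delete Diff_subset)
qed

section \<open>Minors of a disconnected polymatroid\<close>

text \<open>A separation of \<open>M\<close> induces one of \<open>N\<close> by its traces on
  \<open>ground N\<close>, unless one of the traces is empty.\<close>

lemma connected_minor_in_side:
  assumes sub: "submodular_pm M" and ext: "rk M \<in> extensional (Pow (ground M))"
    and sep: "separation (ground M) (rk M) A B"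
    and min: "pm_minor N M" and conn: "pm_connected N"
  shows "ground N \<subseteq> A \<or> ground N \<subseteq> B"
proof -
  have "rk M {} = 0" using sub unfolding submodular_on_def by auto
  from pm_minorE[OF min ext this] obtain C where C: "ground N \<subseteq> ground M" "C \<subseteq> ground M - ground N"
    "rk N = (\<lambda>X\<in>Pow (ground N). rk M (X \<union> C) - rk M C)" .
  have AB: "A \<inter> B = {}" "A \<union> B = ground M" using sep unfolding separation_def by auto
  note split = separation_split[OF sub sep]
  let ?X = "ground N \<inter> A" and ?Y = "ground N \<inter> B"
  have i: "(?X \<union> C) \<inter> A = (ground N \<union> C) \<inter> A" "(?X \<union> C) \<inter> B = C \<inter> B"
    "(?Y \<union> C) \<inter> B = (ground N \<union> C) \<inter> B" "(?Y \<union> C) \<inter> A = C \<inter> A" using AB by auto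
  have s: "?X \<union> C \<subseteq> ground M" "?Y \<union> C \<subseteq> ground M" "ground N \<union> C \<subseteq> ground M" "C \<subseteq> ground M"
    using C AB by auto
  \<comment> \<open>Once all four ranks are split along \<open>A\<close> and \<open>B\<close>, the
    parts \<open>C \<inter> A\<close> and \<open>C \<inter> B\<close> recombine to
    \<open>C\<close>.\<close>
  have "rk N ?X + rk N ?Y = rk N (ground N)"
    using split[OF s(1)] split[OF s(2)] split[OF s(3)] split[OF s(4)] unfolding i
    by (simp add: C(3))
  moreover have "\<not> separation (ground N) (rk N) ?X ?Y" using conn unfolding pm_connected_iff by blast
  ultimately have "?X = {} \<or> ?Y = {}" using AB C(1) unfolding separation_def by blast
  thus ?thesis using AB C(1) by blast
qed

text \<open>Ranks split along \<open>A\<close> and \<open>B\<close>, so whatever is contracted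
  inside \<open>B\<close> does not affect ranks on \<open>A\<close>. Hence \<open>C\<close> may be
  replaced by \<open>C \<inter> A\<close>, after which \<open>b\<close> can be deleted or contracted
  freely.\<close>

lemma minor_delete_contract_side:
  assumes sub: "submodular_pm M" and ext: "rk M \<in> extensional (Pow (ground M))"
    and sep: "separation (ground M) (rk M) A B"
    and min: "pm_minor N M" and NA: "ground N \<subseteq> A" and b: "b \<in> B"
  shows "pm_minor N (pm_delete M {b})" "pm_minor N (pm_contract M {b})"
proof -
  have "rk M {} = 0" using sub unfolding submodular_on_def by auto
  from pm_minorE[OF min ext this] obtain C where C: "ground N \<subseteq> ground M" "C \<subseteq> ground M - ground N"
    "rk N = (\<lambda>X\<in>Pow (ground N). rk M (X \<union> C) - rk M C)" .
  have AB: "A \<inter> B = {}" "A \<union> B = ground M" using sep unfolding separation_def by auto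
  note split = separation_split[OF sub sep]
  let ?D = "C \<inter> A"
  have g: "ground N \<subseteq> ground M - {b}" "?D \<subseteq> ground M - {b} - ground N"
    using C AB NA b by auto
  have D: "rk M (X \<union> C) - rk M C = rk M (X \<union> ?D) - rk M ?D"
    and Db: "rk M (X \<union> ?D \<union> {b}) - rk M (?D \<union> {b}) = rk M (X \<union> ?D) - rk M ?D"
    if X: "X \<subseteq> ground N" for X
  proof -
    have "(X \<union> C) \<inter> A = X \<union> ?D" "(X \<union> C) \<inter> B = C \<inter> B" "(X \<union> ?D \<union> {b}) \<inter> A = X \<union> ?D"
      "(X \<union> ?D \<union> {b}) \<inter> B = {b}" "(?D \<union> {b}) \<inter> A = ?D" "(?D \<union> {b}) \<inter> B = {b}"
      using X NA AB b by auto
    moreover have "X \<union> C \<subseteq> ground M" "C \<subseteq> ground M" "X \<union> ?D \<union> {b} \<subseteq> ground M" "?D \<union> {b} \<subseteq> ground M"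
      using X NA AB b C by auto
    ultimately show "rk M (X \<union> C) - rk M C = rk M (X \<union> ?D) - rk M ?D"
      "rk M (X \<union> ?D \<union> {b}) - rk M (?D \<union> {b}) = rk M (X \<union> ?D) - rk M ?D"
      using split[of "X \<union> C"] split[of C] split[of "X \<union> ?D \<union> {b}"] split[of "?D \<union> {b}"] by simp_all
  qed
  have del: "rk (pm_delete M {b}) (X \<union> ?D) - rk (pm_delete M {b}) ?D = rk M (X \<union> C) - rk M C"
    and con: "rk (pm_contract M {b}) (X \<union> ?D) - rk (pm_contract M {b}) ?D = rk M (X \<union> C) - rk M C"
    if X: "X \<subseteq> ground N" for X
  proof -
    have "X \<union> ?D \<subseteq> ground M - {b}" "?D \<subseteq> ground M - {b}" using X g by auto
    thus "rk (pm_delete M {b}) (X \<union> ?D) - rk (pm_delete M {b}) ?D = rk M (X \<union> C) - rk M C"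
      "rk (pm_contract M {b}) (X \<union> ?D) - rk (pm_contract M {b}) ?D = rk M (X \<union> C) - rk M C"
      using D[OF X] Db[OF X] by (simp_all add: rk_pm_delete rk_pm_contract)
  qed
  show "pm_minor N (pm_delete M {b})"
    using g by (intro pm_minorI[where C = ?D]) (auto simp: C(3) del fun_eq_iff)
  show "pm_minor N (pm_contract M {b})"
    using g by (intro pm_minorI[where C = ?D]) (auto simp: C(3) con fun_eq_iff)
qed

section \<open>Commuting single-element operations\<close>

lemma pm_delete_delete_commute: "pm_delete (pm_delete M S) T = pm_delete (pm_delete M T) S"
  by (auto simp: pm_delete_def fun_eq_iff)

lemma pm_contract_contract_commute:
  assumes "S \<subseteq> ground M" "T \<subseteq> ground M" "S \<inter> T = {}"
  shows "pm_contract (pm_contract M S) T = pm_contract (pm_contract M T) S"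
proof -
  have "T \<subseteq> ground M - S" "S \<subseteq> ground M - T" using assms by auto
  thus ?thesis by (auto simp: pm_contract_def fun_eq_iff Un_ac)
qed

lemma pm_delete_contract_commute:
  assumes "S \<subseteq> ground M" "T \<subseteq> ground M" "S \<inter> T = {}"
  shows "pm_contract (pm_delete M S) T = pm_delete (pm_contract M T) S"
proof -
  have "T \<subseteq> ground M - S" using assms by auto
  thus ?thesis using assms by (auto simp: pm_contract_def pm_delete_def fun_eq_iff)
qed

text \<open>Exchanging the order makes the removal of \<open>b\<close> come first. This carries
  minors found after removing \<open>e\<close> and \<open>b\<close> over to the removal of
  \<open>b\<close> alone.\<close>

lemma pm_minor_delete_contract:
  assumes "e \<in> ground M" "b \<in> ground M" "e \<noteq> b"
  shows "pm_minor (pm_delete (pm_delete M {e}) {b}) (pm_delete M {b})"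
    "pm_minor (pm_contract (pm_delete M {e}) {b}) (pm_contract M {b})"
    "pm_minor (pm_delete (pm_contract M {e}) {b}) (pm_delete M {b})"
    "pm_minor (pm_contract (pm_contract M {e}) {b}) (pm_contract M {b})"
proof -
  have e: "{e} \<subseteq> ground M - {b}" using assms by auto
  show "pm_minor (pm_delete (pm_delete M {e}) {b}) (pm_delete M {b})"
    unfolding pm_delete_delete_commute[of M "{e}"] using e by (auto intro: pm_minor.intros)
  show "pm_minor (pm_contract (pm_delete M {e}) {b}) (pm_contract M {b})"
    using e assms by (subst pm_delete_contract_commute) (auto intro: pm_minor.intros)
  show "pm_minor (pm_delete (pm_contract M {e}) {b}) (pm_delete M {b})"
    using e assms by (subst pm_delete_contract_commute[symmetric]) (auto intro: pm_minor.intros)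
  show "pm_minor (pm_contract (pm_contract M {e}) {b}) (pm_contract M {b})"
    using e assms by (subst pm_contract_contract_commute) (auto intro: pm_minor.intros)
qed

section \<open>The descent and the theorem\<close>

text \<open>Induction on the size of the side \<open>B\<close> that avoids \<open>N\<close>, with
  \<open>M\<close> and \<open>N\<close> fixed. If the removal \<open>L\<close> of some
  \<open>b\<close> in \<open>B\<close> is disconnected, the hypothesis applies to \<open>b\<close>,
  \<open>L\<close> and a separation of \<open>L\<close> whose side avoiding \<open>N\<close> lies in
  \<open>B - {b}\<close>.\<close>

lemma connected_minor_descent:
  assumes fin: "finite (ground M)" and sub: "submodular_pm M" and conn: "pm_connected M"
    and e: "e \<in> ground M" and NA: "ground N \<subseteq> A"
    and K: "K = pm_delete M {e} \<or> K = pm_contract M {e}"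
    and min: "pm_minor N K" and sep: "separation (ground K) (rk K) A B"
  shows "\<exists>b \<in> ground M - ground N.
           (pm_connected (pm_delete M {b}) \<and> pm_minor N (pm_delete M {b})) \<or>
           (pm_connected (pm_contract M {b}) \<and> pm_minor N (pm_contract M {b}))"
  using e NA K min sep
proof (induction "card B" arbitrary: e A B K rule: less_induct)
  case less
  note eM = less.prems(1) and NA = less.prems(2) and K = less.prems(3)
    and min = less.prems(4) and sep = less.prems(5)
  have gK: "ground K = ground M - {e}" using K by auto
  hence AB: "A \<inter> B = {}" "A \<union> B = ground M - {e}" "B \<noteq> {}" using sep unfolding separation_def by auto
  then obtain b where b: "b \<in> B" by auto
  hence bM: "b \<in> ground M" "b \<noteq> e" "b \<notin> ground N" using AB NA by auto
  have subK: "submodular_pm K" using K sub eM submodular_pm_delete[of M] submodular_pm_contract[of M "{e}"] by blast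
  have extK: "rk K \<in> extensional (Pow (ground K))" using K by (auto simp: pm_delete_def pm_contract_def)
  \<comment> \<open>\<open>N\<close> is a minor of \<open>K\<close> with \<open>b\<close> deleted
    and of \<open>K\<close> with \<open>b\<close> contracted, because \<open>b\<close> lies on the
    side away from \<open>N\<close>.\<close>
  have minors: "pm_minor N (pm_delete M {b})" "pm_minor N (pm_contract M {b})"
    using minor_delete_contract_side[OF subK extK sep min NA b] K
      pm_minor_delete_contract[OF eM bM(1) bM(2)[symmetric]] pm_minor_trans by blast+
  have conn': "\<not> separation (ground M) (rk M) P Q" for P Q
    using conn unfolding pm_connected_iff by blast
  \<comment> \<open>Deleting \<open>e\<close> is followed by contracting \<open>b\<close>, and vice versa, so that the separations uncross.\<close>
  define L where "L = (if K = pm_delete M {e} then pm_contract M {b} else pm_delete M {b})"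
  have L: "L = pm_delete M {b} \<or> L = pm_contract M {b}" "pm_minor N L"
    using minors unfolding L_def by auto
  show ?case
  proof (cases "pm_connected L")
    case True
    thus ?thesis using L bM by blast
  next
    case False
    then obtain P Q where PQ: "separation (ground L) (rk L) P Q" unfolding pm_connected_iff by blast
    moreover have "e \<in> P \<union> Q" using PQ L(1) eM bM unfolding separation_def by auto
    ultimately obtain X Y where XY: "separation (ground L) (rk L) X Y" and eX: "e \<in> X"
      using separation_commute by blast
    have YB: "Y \<subseteq> B - {b}"
    proof (cases "K = pm_delete M {e}")
      case True
      with sep XY show ?thesis
        using uncross_deletion_contraction[OF sub conn' eM _ b _ eX]
        by (simp add: L_def separation_pm_contract separation_pm_delete)
    next
      case False
      with K sep XY show ?thesis
        using uncross_contraction_deletion[OF sub conn' eM _ b _ eX]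
        by (simp add: L_def separation_pm_contract separation_pm_delete)
    qed
    have "finite B" using fin AB by (metis finite_Diff finite_Un)
    hence "card Y < card B" using YB b by (intro psubset_card_mono) auto
    \<comment> \<open>\<open>Y\<close> lies in \<open>B\<close> and so misses \<open>A\<close>; what
      remains of \<open>ground M - {b}\<close> is \<open>X\<close>, which therefore contains
      \<open>A\<close>.\<close>
    moreover have "ground N \<subseteq> X"
    proof -
      have "X \<union> Y = ground M - {b}" using XY L(1) unfolding separation_def by auto
      thus ?thesis using NA YB AB b by blast
    qed
    ultimately show ?thesis using less.hyps[OF _ bM(1) _ L XY] by blast
  qed
qed

theorem theorem1p1:
  fixes M N :: "'a polymatroid"
  assumes "k_polymatroid 2 M" and "pm_connected M"
    and "pm_minor N M" and "pm_connected N"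
    and "N \<noteq> M"
  shows "\<exists>e \<in> ground M - ground N.
           (pm_connected (pm_delete M {e}) \<and> pm_minor N (pm_delete M {e})) \<or>
           (pm_connected (pm_contract M {e}) \<and> pm_minor N (pm_contract M {e}))"
proof -
  have M: "finite (ground M)" "rk M \<in> extensional (Pow (ground M))" "rk M {} = 0" "submodular_pm M"
    using assms(1) unfolding k_polymatroid_def submodular_on_def by auto
  obtain C where C: "ground N \<subseteq> ground M" "C \<subseteq> ground M - ground N"
    "rk N = (\<lambda>X\<in>Pow (ground N). rk M (X \<union> C) - rk M C)"
    using pm_minorE[OF assms(3) M(2,3)] .
  \<comment> \<open>Equal ground sets would leave no room for \<open>C\<close>, and extensionality
    would then make \<open>N\<close> and \<open>M\<close> equal as records.\<close>
  have "ground N \<noteq> ground M"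
  proof
    assume g: "ground N = ground M"
    hence "C = {}" using C by auto
    hence "rk N = rk M" using C(3) g M by (simp add: extensional_restrict)
    thus False using g assms(5) by (auto intro: polymatroid.equality)
  qed
  \<comment> \<open>The starting element: if nothing is contracted, any element outside
    \<open>N\<close> can be deleted first; otherwise any element of \<open>C\<close> can be
    contracted first.\<close>
  have "\<exists>e K. e \<in> ground M - ground N \<and> (K = pm_delete M {e} \<or> K = pm_contract M {e}) \<and> pm_minor N K"
  proof (cases "C = {}")
    case True
    obtain e where e: "e \<in> ground M - ground N" using \<open>ground N \<noteq> ground M\<close> C by auto
    have "rk N = (\<lambda>X\<in>Pow (ground N). rk (pm_delete M {e}) (X \<union> {}) - rk (pm_delete M {e}) {})"
      unfolding C(3) True using C(1) e
      by (intro restrict_ext arg_cong2[where f = "(-)"]) (auto intro!: rk_pm_delete[symmetric])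
    hence "pm_minor N (pm_delete M {e})" using C(1) e by (intro pm_minorI[where C = "{}"]) auto
    thus ?thesis using e by blast
  next
    case False
    then obtain e where e: "e \<in> C" by auto
    have "rk N = (\<lambda>X\<in>Pow (ground N).
        rk (pm_contract M {e}) (X \<union> (C - {e})) - rk (pm_contract M {e}) (C - {e}))"
      unfolding C(3)
    proof (rule restrict_ext)
      fix X assume X: "X \<in> Pow (ground N)"
      hence "X \<union> (C - {e}) \<subseteq> ground M - {e}" "C - {e} \<subseteq> ground M - {e}"
        "X \<union> (C - {e}) \<union> {e} = X \<union> C" "C - {e} \<union> {e} = C" using C e by auto
      thus "rk M (X \<union> C) - rk M C =
          rk (pm_contract M {e}) (X \<union> (C - {e})) - rk (pm_contract M {e}) (C - {e})"
        by (simp only: rk_pm_contract)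
    qed
    hence "pm_minor N (pm_contract M {e})" using C e by (intro pm_minorI[where C = "C - {e}"]) auto
    thus ?thesis using e C by blast
  qed
  then obtain e K where e: "e \<in> ground M" "e \<notin> ground N"
    and K: "K = pm_delete M {e} \<or> K = pm_contract M {e}" "pm_minor N K" by blast
  show ?thesis
  proof (cases "pm_connected K")
    case True
    thus ?thesis using K e by blast
  next
    case False
    then obtain A B where AB: "separation (ground K) (rk K) A B" unfolding pm_connected_iff by blast
    have subK: "submodular_pm K" using K M e submodular_pm_delete[of M] submodular_pm_contract[of M "{e}"] by blast
    have extK: "rk K \<in> extensional (Pow (ground K))" using K by (auto simp: pm_delete_def pm_contract_def)
    \<comment> \<open>If \<open>N\<close> lies in \<open>B\<close>, the two sides are swapped before
      the descent.\<close>
    from connected_minor_in_side[OF subK extK AB K(2) assms(4)] show ?thesis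
      using connected_minor_descent[OF M(1,4) assms(2) e(1) _ K] AB separation_commute by blast
  qed
qed

end
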